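(* Let $R$ be an integral domain with quotient field $K$ and let $P$ and $Q$ be nonzero strongly primary ideals of $R$. Then $P\cap Q$ is a strongly 2-absorbing primary ideal of $R$.
   Context: Let $R$ be an integral domain with quotient field $K$. A proper ideal $I$ of $R$ is strongly primary if, whenever $xy\in I$ for elements $x,y\in K$, then $x\in I$ or $y^n\in I$ for some $n\geq 1$. An ideal $I$ of $R$ is a strongly 2-absorbing primary ideal if, whenever $xyz\in I$ for elements $x,y,z\in K$, we have either $xy\in I$ or $(yz)^n\in I$ or $(xz)^m\in I$ for some positive integers $n,m$. *)

theory Defs
  imports "HOL-Algebra.Subrings" "HOL-Algebra.Ideal"
begin

text \<open>The domain is a subset \<open>R\<close> of the carrier of the field \<open>K\<close>, and as a ring it is
  \<open>K\<lparr>carrier := R\<rparr>\<close>. So elements of \<open>K\<close> and ideals of \<open>R\<close> live in the same type, and the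
  products and powers below are always taken in \<open>K\<close>.\<close>

locale quotient_field = field K + subdomain R K for R and K (structure) +
  assumes fraction:
    "x \<in> carrier K \<Longrightarrow> \<exists>a\<in>R. \<exists>b\<in>R - {\<zero>}. x = a \<otimes> inv b"

definition strongly_primary :: "'a set \<Rightarrow> ('a, 'm) ring_scheme \<Rightarrow> 'a set \<Rightarrow> bool" where
  "strongly_primary R K I \<longleftrightarrow>
     ideal I (K\<lparr>carrier := R\<rparr>) \<and> I \<noteq> R \<and>
     (\<forall>x\<in>carrier K. \<forall>y\<in>carrier K. x \<otimes>\<^bsub>K\<^esub> y \<in> I \<longrightarrow>
        x \<in> I \<or> (\<exists>n::nat. n \<ge> 1 \<and> y [^]\<^bsub>K\<^esub> n \<in> I))"

definition strongly_2_absorbing_primary ::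
    "'a set \<Rightarrow> ('a, 'm) ring_scheme \<Rightarrow> 'a set \<Rightarrow> bool" where
  "strongly_2_absorbing_primary R K I \<longleftrightarrow>
     ideal I (K\<lparr>carrier := R\<rparr>) \<and>
     (\<forall>x\<in>carrier K. \<forall>y\<in>carrier K. \<forall>z\<in>carrier K. x \<otimes>\<^bsub>K\<^esub> y \<otimes>\<^bsub>K\<^esub> z \<in> I \<longrightarrow>
        x \<otimes>\<^bsub>K\<^esub> y \<in> I \<or>
        (\<exists>n::nat. n \<ge> 1 \<and> (y \<otimes>\<^bsub>K\<^esub> z) [^]\<^bsub>K\<^esub> n \<in> I) \<or>
        (\<exists>m::nat. m \<ge> 1 \<and> (x \<otimes>\<^bsub>K\<^esub> z) [^]\<^bsub>K\<^esub> m \<in> I))"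

end

theory Submission
  imports Defs
begin

text \<open>Let \<open>p\<close> and \<open>q\<close> be the sets of all elements of \<open>K\<close>, not only of \<open>R\<close>, that have a power
  in \<open>P\<close> and in \<open>Q\<close>. They need not lie in \<open>R\<close>, but a product of two elements of \<open>K\<close> that lies in
  \<open>p\<close> has a factor in \<open>p\<close>, and \<open>p\<close> absorbs every element of \<open>K\<close> that has a power in \<open>R\<close>.
  Hence \<open>p\<close> and \<open>q\<close> are comparable: if \<open>b \<in> p - q\<close> and \<open>a \<in> q - p\<close>, then \<open>b = a (b / a)\<close>
  forces \<open>b / a \<in> p\<close>, so \<open>b \<in> q\<close>. Say \<open>p \<subseteq> q\<close> and \<open>xyz \<in> P \<inter> Q\<close>. If
  \<open>x \<notin> p\<close> then \<open>yz \<in> p\<close>, and if \<open>y \<notin> p\<close> then \<open>xz \<in> p\<close>. If \<open>x, y \<in> p\<close>, then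
  either \<open>z \<in> q\<close> and \<open>xz \<in> p\<close>, or no power of \<open>z\<close> lies in \<open>P\<close> or \<open>Q\<close> and \<open>xy \<in> P \<inter> Q\<close>.\<close>

text \<open>The set \<open>I\<close> is arbitrary because \<open>I = R\<close> is used as well.
  There \<open>n \<ge> 1\<close> matters: exponent 0 would admit every element, as
  \<open>\<one> \<in> R\<close>.\<close>

definition power_radical :: "('a, 'm) ring_scheme \<Rightarrow> 'a set \<Rightarrow> 'a set" where
  "power_radical K I = {x \<in> carrier K. \<exists>n::nat. n \<ge> 1 \<and> x [^]\<^bsub>K\<^esub> n \<in> I}"

lemma power_radicalI:
  "x \<in> carrier K \<Longrightarrow> n \<ge> 1 \<Longrightarrow> x [^]\<^bsub>K\<^esub> (n::nat) \<in> I \<Longrightarrow> x \<in> power_radical K I"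
  unfolding power_radical_def by blast

lemma power_radicalE:
  assumes "x \<in> power_radical K I"
  obtains n :: nat where "x \<in> carrier K" "n \<ge> 1" "x [^]\<^bsub>K\<^esub> n \<in> I"
  using assms unfolding power_radical_def by blast

lemma power_radical_mono: "I \<subseteq> J \<Longrightarrow> power_radical K I \<subseteq> power_radical K J"
  unfolding power_radical_def by blast

lemma strongly_primaryD:
  assumes "strongly_primary R K I" "x \<in> carrier K" "y \<in> carrier K" "x \<otimes>\<^bsub>K\<^esub> y \<in> I"
  shows "x \<in> I \<or> y \<in> power_radical K I"
  using assms unfolding strongly_primary_def power_radical_def by blast

lemma strongly_primary_ideal: "strongly_primary R K I \<Longrightarrow> ideal I (K\<lparr>carrier := R\<rparr>)"
  unfolding strongly_primary_def by blast

lemma ideal_carrier_update_subset: "ideal I (K\<lparr>carrier := R\<rparr>) \<Longrightarrow> I \<subseteq> R"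
  using ideal.Icarr by fastforce

lemma ideal_carrier_update_closed:
  "ideal I (K\<lparr>carrier := R\<rparr>) \<Longrightarrow> a \<in> I \<Longrightarrow> r \<in> R \<Longrightarrow> a \<otimes>\<^bsub>K\<^esub> r \<in> I"
  using ideal.I_r_closed by fastforce

context quotient_field
begin

lemma nat_pow_mem: "x \<in> R \<Longrightarrow> x [^] (n::nat) \<in> R"
  by (induction n) auto

text \<open>As \<open>x\<close> may lie outside \<open>R\<close>, the power after
  \<open>x [^] n\<close> can leave \<open>I\<close>. Multiples of \<open>n\<close> are safe: one
  factor \<open>x [^] n\<close> stays in \<open>I\<close>, and the others lie in
  \<open>R\<close>.\<close>

lemma ideal_nat_pow_mult:
  assumes I: "ideal I (K\<lparr>carrier := R\<rparr>)"
    and x: "x \<in> carrier K" "x [^] (n::nat) \<in> I" and m: "m \<ge> (1::nat)"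
  shows "x [^] (n * m) \<in> I"
proof -
  have R: "x [^] n \<in> R" using ideal_carrier_update_subset[OF I] x by blast
  obtain k where k: "m = Suc k" using m by (cases m) auto
  have "x [^] (n * m) = x [^] n \<otimes> (x [^] n) [^] k"
    using x(1) by (simp add: k nat_pow_mult nat_pow_pow)
  then show ?thesis
    using ideal_carrier_update_closed[OF I x(2) nat_pow_mem[OF R]] by simp
qed

text \<open>The common exponent \<open>n * m\<close> puts the power of \<open>x\<close> in
  \<open>I\<close> and that of \<open>y\<close>, a power of \<open>y [^] m\<close>, in
  \<open>R\<close>.\<close>

lemma power_radical_mult:
  assumes I: "ideal I (K\<lparr>carrier := R\<rparr>)"
    and x: "x \<in> power_radical K I" and y: "y \<in> power_radical K R"
  shows "x \<otimes> y \<in> power_radical K I"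
proof -
  obtain n :: nat where n: "x \<in> carrier K" "n \<ge> 1" "x [^] n \<in> I"
    using x by (rule power_radicalE)
  obtain m :: nat where m: "y \<in> carrier K" "m \<ge> 1" "y [^] m \<in> R"
    using y by (rule power_radicalE)
  have "y [^] (n * m) = (y [^] m) [^] n"
    using m(1) by (simp add: nat_pow_pow mult.commute)
  then have "y [^] (n * m) \<in> R" using nat_pow_mem[OF m(3)] by simp
  then have "(x \<otimes> y) [^] (n * m) \<in> I"
    using n m ideal_carrier_update_closed[OF I ideal_nat_pow_mult[OF I n(1,3) m(2)]]
    by (simp add: nat_pow_distrib)
  then show ?thesis using n m by (intro power_radicalI[where n = "n * m"]) auto
qed

lemma power_radical_subset: "ideal I (K\<lparr>carrier := R\<rparr>) \<Longrightarrow> power_radical K I \<subseteq> power_radical K R"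
  using power_radical_mono[OF ideal_carrier_update_subset] .

lemma zero_mem_power_radical:
  assumes "ideal I (K\<lparr>carrier := R\<rparr>)"
  shows "\<zero> \<in> power_radical K I"
proof -
  have "\<zero> \<in> I"
    using additive_subgroup.zero_closed[OF ideal.axioms(1)[OF assms]] by simp
  then show ?thesis by (intro power_radicalI[where n = 1]) auto
qed

lemma power_radical_Int:
  assumes I: "ideal I (K\<lparr>carrier := R\<rparr>)" and J: "ideal J (K\<lparr>carrier := R\<rparr>)"
  shows "power_radical K (I \<inter> J) = power_radical K I \<inter> power_radical K J"
proof
  show "power_radical K (I \<inter> J) \<subseteq> power_radical K I \<inter> power_radical K J"
    by (simp add: power_radical_mono)
  show "power_radical K I \<inter> power_radical K J \<subseteq> power_radical K (I \<inter> J)"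
  proof
    fix x assume x: "x \<in> power_radical K I \<inter> power_radical K J"
    obtain n :: nat where n: "x \<in> carrier K" "n \<ge> 1" "x [^] n \<in> I"
      using x by (blast elim: power_radicalE)
    obtain m :: nat where m: "m \<ge> 1" "x [^] m \<in> J"
      using x by (blast elim: power_radicalE)
    have "x [^] (n * m) \<in> I \<inter> J"
      using ideal_nat_pow_mult[OF I n(1,3) m(1)] ideal_nat_pow_mult[OF J n(1) m(2) n(2)]
      by (simp add: mult.commute)
    then show "x \<in> power_radical K (I \<inter> J)"
      using n m by (intro power_radicalI[where n = "n * m"]) auto
  qed
qed

text \<open>Strong primariness applies to the product of \<open>x [^] n\<close> and
  \<open>y [^] n\<close>, and a power of \<open>y [^] n\<close> is again a power of
  \<open>y\<close>.\<close>

lemma power_radical_strongly_prime: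
  assumes P: "strongly_primary R K P"
    and x: "x \<in> carrier K" and y: "y \<in> carrier K" and xy: "x \<otimes> y \<in> power_radical K P"
  shows "x \<in> power_radical K P \<or> y \<in> power_radical K P"
proof -
  obtain n :: nat where n: "n \<ge> 1" "(x \<otimes> y) [^] n \<in> P"
    using xy by (rule power_radicalE)
  then have "x [^] n \<otimes> y [^] n \<in> P" using x y by (simp add: nat_pow_distrib)
  then consider "x [^] n \<in> P" | "y [^] n \<in> power_radical K P"
    using strongly_primaryD[OF P] x y by blast
  then show ?thesis
  proof cases
    case 1
    then show ?thesis using x n by (blast intro: power_radicalI)
  next
    case 2
    then obtain m :: nat where m: "m \<ge> 1" "(y [^] n) [^] m \<in> P" by (rule power_radicalE)
    then have "y \<in> power_radical K P"
      using y n by (intro power_radicalI[where n = "n * m"]) (auto simp: nat_pow_pow)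
    then show ?thesis ..
  qed
qed

lemma power_radical_comparable:
  assumes P: "strongly_primary R K P" and Q: "strongly_primary R K Q"
  shows "power_radical K P \<subseteq> power_radical K Q \<or> power_radical K Q \<subseteq> power_radical K P"
proof (rule ccontr)
  note idP = strongly_primary_ideal[OF P] and idQ = strongly_primary_ideal[OF Q]
  assume "\<not> ?thesis"
  then obtain a b where b: "b \<in> power_radical K P" "b \<notin> power_radical K Q"
    and a: "a \<in> power_radical K Q" "a \<notin> power_radical K P" by blast
  have carr: "a \<in> carrier K" "b \<in> carrier K" using a b by (auto elim: power_radicalE)
  \<comment> \<open>Zero lies in the radical of \<open>P\<close>, which \<open>a\<close> avoids; so
    division by \<open>a\<close> is possible in \<open>K\<close>.\<close>
  have "a \<noteq> \<zero>" using a zero_mem_power_radical[OF idP] by blast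
  then have a_Unit: "a \<in> Units K" using carr by (simp add: field_Units)
  then have inv_a: "inv a \<in> carrier K" "a \<otimes> inv a = \<one>" by auto
  have eq: "a \<otimes> (inv a \<otimes> b) = b"
    using carr inv_a by (simp add: m_assoc[symmetric])
  then have "inv a \<otimes> b \<in> power_radical K P"
    using power_radical_strongly_prime[OF P, of a "inv a \<otimes> b"] carr inv_a a b by simp
  \<comment> \<open>The quotient has a power in \<open>P\<close>, hence in \<open>R\<close>, so the
    radical of \<open>Q\<close> absorbs it.\<close>
  then have "a \<otimes> (inv a \<otimes> b) \<in> power_radical K Q"
    using power_radical_mult[OF idQ a(1)] power_radical_subset[OF idP] by blast
  then show False using b eq by simp
qed

lemma Int_absorbing_cases:
  assumes P: "strongly_primary R K P" and Q: "strongly_primary R K Q"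
    and sub: "power_radical K P \<subseteq> power_radical K Q"
    and carr: "x \<in> carrier K" "y \<in> carrier K" "z \<in> carrier K"
    and xyz: "x \<otimes> y \<otimes> z \<in> P \<inter> Q"
  shows "x \<otimes> y \<in> P \<inter> Q \<or> y \<otimes> z \<in> power_radical K (P \<inter> Q) \<or> x \<otimes> z \<in> power_radical K (P \<inter> Q)"
proof -
  note idP = strongly_primary_ideal[OF P] and idQ = strongly_primary_ideal[OF Q]
  \<comment> \<open>By \<open>sub\<close>, the last two alternatives only ask for membership in the
    radical of \<open>P\<close>.\<close>
  have Int: "power_radical K (P \<inter> Q) = power_radical K P"
    using power_radical_Int[OF idP idQ] sub by blast
  have prod: "x \<otimes> y \<otimes> z \<in> power_radical K P"
    using xyz carr by (intro power_radicalI[where n = 1]) auto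
  have "x \<otimes> (y \<otimes> z) = x \<otimes> y \<otimes> z" "y \<otimes> (x \<otimes> z) = x \<otimes> y \<otimes> z"
    using carr by (simp_all add: m_ac)
  then have x: "x \<in> power_radical K P \<or> y \<otimes> z \<in> power_radical K P"
    and y: "y \<in> power_radical K P \<or> x \<otimes> z \<in> power_radical K P"
    using prod carr power_radical_strongly_prime[OF P, of x "y \<otimes> z"]
      power_radical_strongly_prime[OF P, of y "x \<otimes> z"] by simp_all
  show ?thesis
  proof (cases "z \<in> power_radical K Q")
    case True
    then have "x \<in> power_radical K P \<Longrightarrow> x \<otimes> z \<in> power_radical K P"
      using power_radical_mult[OF idP] power_radical_subset[OF idQ] by blast
    then show ?thesis using x Int by blast
  next
    case False
    \<comment> \<open>By \<open>sub\<close>, \<open>z\<close> is outside both radicals, so each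
      ideal must contain the other factor \<open>x \<otimes> y\<close>.\<close>
    then have "x \<otimes> y \<in> P \<inter> Q"
      using strongly_primaryD[OF P, of "x \<otimes> y" z] strongly_primaryD[OF Q, of "x \<otimes> y" z]
        xyz carr sub by blast
    then show ?thesis ..
  qed
qed

end

theorem theorem2p9:
  fixes R :: "'a set" and K :: "('a, 'm) ring_scheme" and P Q :: "'a set"
  assumes "quotient_field R K"
    and "strongly_primary R K P" and "P \<noteq> {\<zero>\<^bsub>K\<^esub>}"
    and "strongly_primary R K Q" and "Q \<noteq> {\<zero>\<^bsub>K\<^esub>}"
  shows "strongly_2_absorbing_primary R K (P \<inter> Q)"
proof -
  interpret quotient_field R K by fact
  note P = assms(2) and Q = assms(4)
  have "ideal (P \<inter> Q) (K\<lparr>carrier := R\<rparr>)"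
    using ring.i_intersect[OF ideal.axioms(2)] strongly_primary_ideal[OF P] strongly_primary_ideal[OF Q]
    by blast
  moreover have "x \<otimes>\<^bsub>K\<^esub> y \<in> P \<inter> Q \<or> y \<otimes>\<^bsub>K\<^esub> z \<in> power_radical K (P \<inter> Q)
      \<or> x \<otimes>\<^bsub>K\<^esub> z \<in> power_radical K (P \<inter> Q)"
    if "x \<in> carrier K" "y \<in> carrier K" "z \<in> carrier K" "x \<otimes>\<^bsub>K\<^esub> y \<otimes>\<^bsub>K\<^esub> z \<in> P \<inter> Q" for x y z
    using power_radical_comparable[OF P Q]
  proof
    assume "power_radical K P \<subseteq> power_radical K Q"
    then show ?thesis using Int_absorbing_cases[OF P Q] that by blast
  next
    \<comment> \<open>The claim is symmetric in \<open>P\<close> and \<open>Q\<close>.\<close>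
    assume "power_radical K Q \<subseteq> power_radical K P"
    then show ?thesis using Int_absorbing_cases[OF Q P] that by (simp add: Int_commute)
  qed
  ultimately show ?thesis
    unfolding strongly_2_absorbing_primary_def power_radical_def by blast
qed

end
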